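(* Let $N$ be a positive integer, let $x\in\{-1,1\}^{\mathbb{Z}/N\mathbb{Z}}$ and $y\in\{-1,1\}^{\mathbb{Z}}$, and suppose $\Sigma(x)=0$. For every hitomezashi loop $L$ of homology class $1$ in the cylindrical hitomezashi pattern $\mathrm{Cloth}_{\mathbb{Z}\times\mathbb{Z}/N\mathbb{Z}}(x,y)$, the bounding sequence of $L$ is minimally positively overflowing. Conversely, if $m\le M$ are integers such that $y_m,y_{m+1},\ldots,y_M$ is minimally positively overflowing, then there exists a unique hitomezashi loop $L$ of homology class $1$ in $\mathrm{Cloth}_{\mathbb{Z}\times\mathbb{Z}/N\mathbb{Z}}(x,y)$ whose bounding sequence is $y_m,y_{m+1},\ldots,y_M$. The analogous statements hold with homology class $-1$ in place of $1$ and "minimally negatively overflowing" in place of "minimally positively overflowing".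
   Context: Oriented hitomezashi pattern: for $G=\mathbb{Z}$, $H=\mathbb{Z}/N\mathbb{Z}$, $x\in\{-1,1\}^H$, $y\in\{-1,1\}^G$, the pattern $\mathrm{Cloth}_{G\times H}(x,y)$ is the directed graph on vertex set $G\times H$ in which, for each $(i,j)$, the (horizontal) edge between $(i,j)$ and $(i+1,j)$ is oriented $(i,j)\to(i+1,j)$ if $x_j=1$ and $(i+1,j)\to(i,j)$ if $x_j=-1$, and the (vertical) edge between $(i,j)$ and $(i,j+1)$ is oriented $(i,j)\to(i,j+1)$ if $y_i=1$ and $(i,j+1)\to(i,j)$ if $y_i=-1$. A hitomezashi path is a directed path following the orientations and alternating between horizontal and vertical edges; a hitomezashi loop is a closed directed circuit following the orientations and alternating between horizontal and vertical edges. The homology class of a loop $L$ is $\Delta y/N$, where $\Delta y$ is the number of edges of $L$ of the form $(i,j)\to(i,j+1)$ minus the number of edges of $L$ of the form $(i,j+1)\to(i,j)$. Sums: for a sequence $z\in\{-1,1\}^{\mathbb{Z}}$ and integers $a\le b$, $\Sigma_a^b(z)=\sum_{a\le i\le b}z_i$; $\Sigma_{b+1}^b(z)=0$; and for $a>b+1$, $\Sigma_a^b(z)=-\Sigma_{b+1}^{a-1}(z)$. For $x\in\{-1,1\}^{\mathbb{Z}/N\mathbb{Z}}$, its lift is $\tilde x\in\{-1,1\}^{\mathbb{Z}}$ with $\tilde x_i=x_{i\bmod N}$; $\Sigma(x)=\sum_{i\in\mathbb{Z}/N\mathbb{Z}}x_i$ and $\Sigma_a^b(x)=\Sigma_a^b(\tilde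 x)$. When $\Sigma(x)=0$, the range $r(x)=\sup\{\Sigma_a^b(x):a\le b+1\}=-\inf\{\Sigma_a^b(x):a\le b+1\}$ (finite). The bounding cylinder of a loop $L$ is the smallest set of the form $\{(u,v): m\le u\le M\}$ containing $L$, and its bounding sequence is $y_m,y_{m+1},\ldots,y_M$. A consecutive subsequence $y_m,\ldots,y_M$ of $y$ is positively overflowing if $\Sigma_m^M(y)>r(x)$, and negatively overflowing if $\Sigma_m^M(y)<-r(x)$; it is minimally positively (resp. negatively) overflowing if it is positively (resp. negatively) overflowing and for no indices $m<m'\le M'<M$ is $y_{m'},\ldots,y_{M'}$ positively (resp. negatively) overflowing.
   Formalization: "Minimally overflowing" is taken to mean that no proper consecutive subsequence (including those sharing one end) is overflowing; with only m<m'≤M'<M the converse fails, e.g. N=2, x=(1,-1), y constantly 1, segment 1,1,1. *)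

theory Defs
  imports Complex_Main "Graph_Theory.Arc_Walk"
begin

text \<open>
  The group \<open>\<int>/N\<int>\<close> is represented by the set \<open>{0..<N}\<close> of integers with addition modulo \<open>N\<close>.
  A sequence \<open>x \<in> {-1,1}\<^sup>H\<close> with \<open>H = \<int>/N\<int>\<close> is a function whose values outside \<open>{0..<N}\<close> are
  irrelevant.

  Edges are labelled objects: \<open>Hor i j\<close> is the edge between \<open>(i,j)\<close> and \<open>(i+1,j)\<close>, and \<open>Ver i j\<close>
  the one between \<open>(i,j)\<close> and \<open>(i,j+1)\<close>. Pairs of vertices would not do, because for \<open>N = 2\<close>
  the two distinct edges \<open>Ver i 0\<close> and \<open>Ver i 1\<close> join the same two vertices.
\<close>

datatype edge = Hor int int | Ver int int

fun is_hor :: "edge \<Rightarrow> bool" where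
  "is_hor (Hor i j) = True"
| "is_hor (Ver i j) = False"

fun cloth_tail :: "int \<Rightarrow> (int \<Rightarrow> int) \<Rightarrow> (int \<Rightarrow> int) \<Rightarrow> edge \<Rightarrow> int \<times> int" where
  "cloth_tail N x y (Hor i j) = (if x j = 1 then (i, j) else (i + 1, j))"
| "cloth_tail N x y (Ver i j) = (if y i = 1 then (i, j) else (i, (j + 1) mod N))"

fun cloth_head :: "int \<Rightarrow> (int \<Rightarrow> int) \<Rightarrow> (int \<Rightarrow> int) \<Rightarrow> edge \<Rightarrow> int \<times> int" where
  "cloth_head N x y (Hor i j) = (if x j = 1 then (i + 1, j) else (i, j))"
| "cloth_head N x y (Ver i j) = (if y i = 1 then (i, (j + 1) mod N) else (i, j))"

definition cloth :: "int \<Rightarrow> (int \<Rightarrow> int) \<Rightarrow> (int \<Rightarrow> int) \<Rightarrow> (int \<times> int, edge) pre_digraph" where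
  "cloth N x y =
    \<lparr> verts = UNIV \<times> {0..<N},
      arcs = {Hor i j | i j. j \<in> {0..<N}} \<union> {Ver i j | i j. j \<in> {0..<N}},
      tail = cloth_tail N x y,
      head = cloth_head N x y \<rparr>"

text \<open>
  A closed circuit, listed from one of its edges on: a nonempty closed walk without repeated edges
  that alternates cyclically, i.e. also from its last edge to its first.
\<close>

definition hitomezashi_circuit :: "int \<Rightarrow> (int \<Rightarrow> int) \<Rightarrow> (int \<Rightarrow> int) \<Rightarrow> edge list \<Rightarrow> bool" where
  "hitomezashi_circuit N x y p \<longleftrightarrow>
    p \<noteq> [] \<and> (\<exists>u. pre_digraph.trail (cloth N x y) u p u) \<and>
    (\<forall>k<length p. is_hor (p ! (Suc k mod length p)) \<noteq> is_hor (p ! k))"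

text \<open>
  A loop has no distinguished starting edge, so it is the set of all rotations of a circuit.
\<close>

definition hitomezashi_loop :: "int \<Rightarrow> (int \<Rightarrow> int) \<Rightarrow> (int \<Rightarrow> int) \<Rightarrow> edge list set \<Rightarrow> bool" where
  "hitomezashi_loop N x y L \<longleftrightarrow>
    (\<exists>p. hitomezashi_circuit N x y p \<and> L = {rotate k p | k. True})"

definition loop_edges :: "edge list set \<Rightarrow> edge set" where
  "loop_edges L = (\<Union>p\<in>L. set p)"

definition loop_verts ::
  "int \<Rightarrow> (int \<Rightarrow> int) \<Rightarrow> (int \<Rightarrow> int) \<Rightarrow> edge list set \<Rightarrow> (int \<times> int) set" where
  "loop_verts N x y L =
    tail (cloth N x y) ` loop_edges L \<union> head (cloth N x y) ` loop_edges L"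

text \<open>
  The edge \<open>Ver i j\<close> is directed from \<open>(i,j)\<close> to \<open>(i,j+1)\<close> iff \<open>y i = 1\<close>.
\<close>

definition delta_y :: "(int \<Rightarrow> int) \<Rightarrow> edge list set \<Rightarrow> int" where
  "delta_y y L =
    int (card {e \<in> loop_edges L. \<exists>i j. e = Ver i j \<and> y i = 1}) -
    int (card {e \<in> loop_edges L. \<exists>i j. e = Ver i j \<and> y i = - 1})"

definition homology_class :: "int \<Rightarrow> (int \<Rightarrow> int) \<Rightarrow> edge list set \<Rightarrow> rat" where
  "homology_class N y L = of_int (delta_y y L) / of_int N"

definition cylinder :: "int \<Rightarrow> int \<Rightarrow> int \<Rightarrow> (int \<times> int) set" where
  "cylinder N m M = {m..M} \<times> {0..<N}"

text \<open>
  The bounding sequence of \<open>L\<close> is \<open>y m, \<dots>, y M\<close>. It is a segment of \<open>y\<close>, determined by its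
  end indices and not merely by its list of values.
\<close>

definition bounding_sequence ::
  "int \<Rightarrow> (int \<Rightarrow> int) \<Rightarrow> (int \<Rightarrow> int) \<Rightarrow> edge list set \<Rightarrow> int \<Rightarrow> int \<Rightarrow> bool" where
  "bounding_sequence N x y L m M \<longleftrightarrow>
    m \<le> M \<and> loop_verts N x y L \<subseteq> cylinder N m M \<and>
    (\<forall>m' M'. loop_verts N x y L \<subseteq> cylinder N m' M' \<longrightarrow> cylinder N m M \<subseteq> cylinder N m' M')"

lemma bounding_sequence_unique:
  assumes "N > 0" "bounding_sequence N x y L m M" "bounding_sequence N x y L m' M'"
  shows "m = m' \<and> M = M'"
proof -
  have "cylinder N m M = cylinder N m' M'"
    using assms unfolding bounding_sequence_def by blast
  moreover have "{0..<N} \<noteq> {}" using assms(1) by auto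
  ultimately have "{m..M} = {m'..M'}"
    unfolding cylinder_def by (simp add: times_eq_iff)
  moreover have "m \<le> M" "m' \<le> M'"
    using assms by (auto simp: bounding_sequence_def)
  ultimately show ?thesis by (simp add: Icc_eq_Icc)
qed

definition Sigma_sum :: "(int \<Rightarrow> int) \<Rightarrow> int \<Rightarrow> int \<Rightarrow> int" where
  "Sigma_sum z a b =
    (if a \<le> b then (\<Sum>i\<in>{a..b}. z i)
     else if a = b + 1 then 0
     else - (\<Sum>i\<in>{b + 1..a - 1}. z i))"

definition lift :: "int \<Rightarrow> (int \<Rightarrow> int) \<Rightarrow> int \<Rightarrow> int" where
  "lift N x i = x (i mod N)"

definition total_sum :: "int \<Rightarrow> (int \<Rightarrow> int) \<Rightarrow> int" where
  "total_sum N x = (\<Sum>j\<in>{0..<N}. x j)"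

text \<open>
  The supremum is meaningful only if the set is bounded, as it is when \<open>total_sum N x = 0\<close>.
\<close>

definition sum_range :: "int \<Rightarrow> (int \<Rightarrow> int) \<Rightarrow> int" where
  "sum_range N x = Sup {Sigma_sum (lift N x) a b | a b. a \<le> b + 1}"

definition pos_overflowing :: "int \<Rightarrow> (int \<Rightarrow> int) \<Rightarrow> (int \<Rightarrow> int) \<Rightarrow> int \<Rightarrow> int \<Rightarrow> bool" where
  "pos_overflowing N x y m M \<longleftrightarrow> Sigma_sum y m M > sum_range N x"

definition neg_overflowing :: "int \<Rightarrow> (int \<Rightarrow> int) \<Rightarrow> (int \<Rightarrow> int) \<Rightarrow> int \<Rightarrow> int \<Rightarrow> bool" where
  "neg_overflowing N x y m M \<longleftrightarrow> Sigma_sum y m M < - sum_range N x"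

text \<open>
  Minimality ranges over all proper consecutive subsequences, including those that share one end
  with the whole. If only \<open>m < m' \<le> M' < M\<close> were considered, then for \<open>N = 2\<close>, \<open>x = (1,-1)\<close> and
  constant \<open>y = 1\<close> (where \<open>sum_range N x = 1\<close>) the segment \<open>1,1,1\<close> would count as minimal, but
  every loop there has a bounding sequence of length 2.
\<close>

definition min_pos_overflowing :: "int \<Rightarrow> (int \<Rightarrow> int) \<Rightarrow> (int \<Rightarrow> int) \<Rightarrow> int \<Rightarrow> int \<Rightarrow> bool" where
  "min_pos_overflowing N x y m M \<longleftrightarrow>
    pos_overflowing N x y m M \<and>
    \<not> (\<exists>m' M'. m \<le> m' \<and> m' \<le> M' \<and> M' \<le> M \<and> (m', M') \<noteq> (m, M) \<and>
         pos_overflowing N x y m' M')"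

definition min_neg_overflowing :: "int \<Rightarrow> (int \<Rightarrow> int) \<Rightarrow> (int \<Rightarrow> int) \<Rightarrow> int \<Rightarrow> int \<Rightarrow> bool" where
  "min_neg_overflowing N x y m M \<longleftrightarrow>
    neg_overflowing N x y m M \<and>
    \<not> (\<exists>m' M'. m \<le> m' \<and> m' \<le> M' \<and> M' \<le> M \<and> (m', M') \<noteq> (m, M) \<and>
         neg_overflowing N x y m' M')"

end

theory Submission
  imports Defs
begin

text \<open>
  With \<open>X\<close> and \<open>Y\<close> the partial sums of \<open>x\<close> and \<open>y\<close>, give the face with lower left corner \<open>(i,j)\<close>
  the height \<open>X j - Y i\<close>. A hitomezashi path is a level line of this height: the faces on its left
  all have one height \<open>c\<close> and those on its right have height \<open>c - 1\<close>. A horizontal edge of level \<open>c\<close>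
  over the columns \<open>i\<close>, \<open>i + 1\<close> forces \<open>min X - c < Y i < max X - c + 1\<close>. A loop of nonzero class has
  to pass the rows where \<open>X\<close> is minimal and maximal, which it can only do where \<open>Y\<close> attains these two
  bounds, that is, at the two ends of its bounding cylinder. Hence the bounding sequence rises or falls
  from one bound to the other, staying strictly between them inside, which is minimal overflow. In a
  row where \<open>X\<close> is minimal the loop has a single edge; its direction gives the class, and it determines
  the loop. Conversely, the path through that edge cannot leave the cylinder.
\<close>

section \<open>Partial sums and minimally overflowing segments\<close>

lemma Sigma_sum_step: "Sigma_sum z a b = Sigma_sum z a (b - 1) + z b"
proof -
  consider "a < b" | "a = b" | "a = b + 1" | "a > b + 1" by linarith
  then show ?thesis
  proof cases
    case 1
    then have "{a..b} = insert b {a..b - 1}" by auto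
    with 1 show ?thesis by (simp add: Sigma_sum_def)
  next
    case 4
    then have "{b..a - 1} = insert b {b + 1..a - 1}" by auto
    with 4 show ?thesis by (simp add: Sigma_sum_def)
  qed (auto simp: Sigma_sum_def)
qed

text \<open>The convention for \<open>a > b + 1\<close> makes this telescoping hold for every order
  of \<open>a\<close>, \<open>b\<close> and \<open>k\<close>, so partial sums from one base express
  all sums.\<close>

lemma Sigma_sum_eq_diff: "Sigma_sum z a b = Sigma_sum z k b - Sigma_sum z k (a - 1)"
proof (induction b rule: int_induct[where k = "a - 1"])
  case base
  show ?case by (simp add: Sigma_sum_def)
next
  case (step1 b)
  then show ?case
    using Sigma_sum_step[of z a "b + 1"] Sigma_sum_step[of z k "b + 1"] by simp
next
  case (step2 b)
  then show ?case
    using Sigma_sum_step[of z a b] Sigma_sum_step[of z k b] by simp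
qed

lemma cas_iff_nth:
  assumes "p \<noteq> []"
  shows "pre_digraph.cas G u p v \<longleftrightarrow>
    tail G (p ! 0) = u \<and> head G (last p) = v \<and>
    (\<forall>k. Suc k < length p \<longrightarrow> tail G (p ! Suc k) = head G (p ! k))"
  using assms
proof (induction p arbitrary: u rule: list_nonempty_induct)
  case (single e)
  then show ?case by (simp add: pre_digraph.cas.simps)
next
  case (cons e p)
  then show ?case
    by (auto simp: pre_digraph.cas.simps nth_Cons split: nat.splits)
qed

text \<open>Since \<open>Z\<close> moves by at most one, a minimal rise above \<open>r\<close> is
  exactly \<open>r + 1\<close>. Comparing the prefix ending at \<open>f\<close> and the suffix
  starting at \<open>f + 1\<close> with \<open>r\<close> gives the two strict bounds. A general
  \<open>Z\<close> serves both \<open>Y\<close> and its negative.\<close>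

lemma minimal_rise_iff:
  fixes Z :: "int \<Rightarrow> int" and r :: int
  assumes step: "\<And>i. \<bar>Z i - Z (i - 1)\<bar> \<le> 1" and "m \<le> M" "r \<ge> 0"
  shows "(Z M - Z (m - 1) > r \<and>
      \<not> (\<exists>m' M'. m \<le> m' \<and> m' \<le> M' \<and> M' \<le> M \<and> (m', M') \<noteq> (m, M) \<and> Z M' - Z (m' - 1) > r))
    \<longleftrightarrow> Z M = Z (m - 1) + r + 1 \<and> (\<forall>f. m \<le> f \<and> f < M \<longrightarrow> Z (m - 1) < Z f \<and> Z f < Z M)"
    (is "?lhs \<longleftrightarrow> ?rhs")
proof
  assume lhs: ?lhs
  then have big: "Z M - Z (m - 1) > r" by blast
  have small: "Z M' - Z (m' - 1) \<le> r"
    if "m \<le> m'" "m' \<le> M'" "M' \<le> M" "m' \<noteq> m \<or> M' \<noteq> M" for m' M'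
    using lhs that by (auto simp: not_less)
  have eq: "Z M = Z (m - 1) + r + 1"
  \<comment> \<open>A single entry has no nonempty proper prefix to compare with; there the step
    bound alone forces \<open>r = 0\<close> and a rise of one.\<close>
  proof (cases "m = M")
    case True
    then show ?thesis using big step[of M] \<open>r \<ge> 0\<close> by auto
  next
    case False
    then show ?thesis using big small[of m "M - 1"] step[of M] \<open>m \<le> M\<close> by auto
  qed
  moreover have "Z (m - 1) < Z f \<and> Z f < Z M" if "m \<le> f" "f < M" for f
    using small[of m f] small[of "f + 1" M] eq that by auto
  ultimately show ?rhs by blast
next
  assume rhs: ?rhs
  have "Z M' - Z (m' - 1) \<le> r"
    if "m \<le> m'" "m' \<le> M'" "M' \<le> M" "m' \<noteq> m \<or> M' \<noteq> M" for m' M'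
  proof -
    have "M' \<noteq> M \<Longrightarrow> Z M' < Z M" using rhs[THEN conjunct2, rule_format, of M'] that by linarith
    moreover have "m' \<noteq> m \<Longrightarrow> Z (m - 1) < Z (m' - 1)"
      using rhs[THEN conjunct2, rule_format, of "m' - 1"] that by linarith
    ultimately show ?thesis using rhs that(4) by (cases "M' = M"; cases "m' = m") auto
  qed
  then show ?lhs using rhs by (auto simp: not_less)
qed

section \<open>Lists up to rotation\<close>

definition rotations :: "'a list \<Rightarrow> 'a list set" where
  "rotations p = {rotate k p | k. True}"

lemma rotations_rotate: "rotations (rotate a p) = rotations p"
proof -
  \<comment> \<open>Rotating by \<open>length p * a - a\<close> undoes the rotation by
    \<open>a\<close>; for nonempty \<open>p\<close> the natural subtraction does not
    truncate.\<close>
  have "rotate k p = rotate (k + (length p * a - a)) (rotate a p)" for k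
  proof (cases "p = []")
    case False
    then have "k + (length p * a - a) + a = k + length p * a" by (cases p) auto
    then show ?thesis
      by (metis mod_mult_self2 rotate_conv_mod rotate_rotate)
  qed simp
  then show ?thesis by (auto simp: rotations_def rotate_rotate)
qed

lemma loop_edges_rotations [simp]: "loop_edges (rotations p) = set p"
  by (auto simp: loop_edges_def rotations_def)

lemma hitomezashi_loop_iff:
  "hitomezashi_loop N x y L \<longleftrightarrow> (\<exists>p. hitomezashi_circuit N x y p \<and> L = rotations p)"
  by (simp add: hitomezashi_loop_def rotations_def)

section \<open>The partial sums \<open>X\<close> and \<open>Y\<close>\<close>

locale cylindrical_cloth =
  fixes N :: int and x y :: "int \<Rightarrow> int"
  assumes N_pos: "N > 0"
    and x_sign: "0 \<le> j \<Longrightarrow> j < N \<Longrightarrow> x j = 1 \<or> x j = -1"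
    and y_sign: "y i = 1 \<or> y i = -1"
    and x_balanced: "total_sum N x = 0"
begin

definition X :: "int \<Rightarrow> int" where "X j = Sigma_sum (lift N x) 1 j"

definition Y :: "int \<Rightarrow> int" where "Y i = Sigma_sum y 1 i"

lemma Sigma_sum_y: "Sigma_sum y m M = Y M - Y (m - 1)"
  unfolding Y_def by (rule Sigma_sum_eq_diff)

lemma Sigma_sum_x: "Sigma_sum (lift N x) a b = X b - X (a - 1)"
  unfolding X_def by (rule Sigma_sum_eq_diff)

lemma Y_step: "Y i = Y (i - 1) + y i"
  unfolding Y_def by (rule Sigma_sum_step)

lemma X_step: "X j = X (j - 1) + x (j mod N)"
  unfolding X_def using Sigma_sum_step[of "lift N x" 1 j] by (simp add: lift_def)

lemma X_add_N: "X (j + N) = X j"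
\<comment> \<open>Starting at -1 makes the first difference the sum over the full period
  \<open>{0..N - 1}\<close>, which vanishes by balance.\<close>
proof (induction j rule: int_induct[where k = "-1"])
  case base
  have "Sigma_sum (lift N x) 0 (N - 1) = (\<Sum>i\<in>{0..N - 1}. x i)"
    using N_pos by (auto simp: Sigma_sum_def lift_def intro!: sum.cong)
  also have "{0..N - 1} = {0..<N}" by auto
  finally show ?case
    using x_balanced Sigma_sum_x[of 0 "N - 1"] by (simp add: total_sum_def)
next
  case (step1 j)
  then show ?case
    using X_step[of "j + 1"] X_step[of "j + 1 + N"] mod_add_self2[of "j + 1" N]
    by (simp add: algebra_simps)
next
  case (step2 j)
  then show ?case
    using X_step[of j] X_step[of "j + N"] by (simp add: algebra_simps)
qed

lemma X_add_mult: "X (j + k * N) = X j"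
proof (induction k rule: int_induct[where k = 0])
  case (step1 k)
  then show ?case using X_add_N[of "j + k * N"] by (simp add: algebra_simps)
next
  case (step2 k)
  then show ?case using X_add_N[of "j + (k - 1) * N"] by (simp add: algebra_simps)
qed simp

lemma X_mod: "X (j mod N) = X j"
  using X_add_mult[of "j mod N" "j div N"] by simp

lemma X_mod_add: "X (j mod N + k) = X (j + k)"
  using X_add_mult[of "j mod N + k" "j div N"]
  by (simp add: algebra_simps)

lemma X_mod_diff: "X (j mod N - k) = X (j - k)"
  using X_mod_add[of j "- k"] by simp

text \<open>Periodicity reduces the extrema to one period, and every \<open>Sigma_sum\<close> of the
  lift is a difference of two values of \<open>X\<close>.\<close>

lemma X_extrema:
  obtains u v where "0 \<le> u" "u < N" "0 \<le> v" "v < N"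
    "\<And>j. X u \<le> X j" "\<And>j. X j \<le> X v" "sum_range N x = X v - X u"
proof -
  have fin: "finite (X ` {0..<N})" "X ` {0..<N} \<noteq> {}" using N_pos by auto
  obtain u where u: "u \<in> {0..<N}" "X u = Min (X ` {0..<N})"
    using Min_in[OF fin] by (metis imageE)
  obtain v where v: "v \<in> {0..<N}" "X v = Max (X ` {0..<N})"
    using Max_in[OF fin] by (metis imageE)
  have j: "X (j mod N) \<in> X ` {0..<N}" for j using N_pos by auto
  have lo: "X u \<le> X j" and hi: "X j \<le> X v" for j
    using Min_le[OF fin(1) j[of j]] Max_ge[OF fin(1) j[of j]] u v by (auto simp: X_mod)
  have "sum_range N x = X v - X u"
    unfolding sum_range_def
  proof (rule cSup_eq_maximum)
    \<comment> \<open>As \<open>v\<close> may lie below \<open>u\<close>, the segment runs once more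
      around, to \<open>v + N\<close>, with the same sum.\<close>
    have "X v - X u = Sigma_sum (lift N x) (u + 1) (v + N)"
      using X_add_N[of v] by (simp add: Sigma_sum_x)
    moreover have "u + 1 \<le> v + N + 1" using u v by simp
    ultimately show "X v - X u \<in> {Sigma_sum (lift N x) a b |a b. a \<le> b + 1}" by blast
  next
    fix s assume "s \<in> {Sigma_sum (lift N x) a b |a b. a \<le> b + 1}"
    then show "s \<le> X v - X u" using lo hi by (auto simp: Sigma_sum_x intro: diff_mono)
  qed
  with u(1) v(1) lo hi show thesis by (intro that[of u v]) auto
qed

section \<open>The successor map and the invariance of the level\<close>

abbreviation A :: "edge set" where "A \<equiv> arcs (cloth N x y)"

lemma Hor_in_A [simp]: "Hor i j \<in> A \<longleftrightarrow> 0 \<le> j \<and> j < N"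
  and Ver_in_A [simp]: "Ver i j \<in> A \<longleftrightarrow> 0 \<le> j \<and> j < N"
  by (auto simp: cloth_def)

lemma tail_cloth [simp]: "tail (cloth N x y) = cloth_tail N x y"
  and head_cloth [simp]: "head (cloth N x y) = cloth_head N x y"
  and verts_cloth [simp]: "verts (cloth N x y) = UNIV \<times> {0..<N}"
  by (auto simp: cloth_def)

text \<open>Each vertex has one outgoing edge of each kind, so an alternating path is an orbit of
  this map, the turn at the head of an edge. A line directed down or left leaves the vertex by the
  edge labelled with the preceding coordinate.\<close>

fun nxt :: "edge \<Rightarrow> edge" where
  "nxt (Hor i j) = (let i' = if x j = 1 then i + 1 else i
    in Ver i' (if y i' = 1 then j else (j - 1) mod N))"
| "nxt (Ver i j) = (let j' = if y i = 1 then (j + 1) mod N else j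
    in Hor (if x j' = 1 then i else i - 1) j')"

text \<open>The height of the face to the left of a directed edge.\<close>

fun level :: "edge \<Rightarrow> int" where
  "level (Hor i j) = max (X (j - 1)) (X j) - Y i"
| "level (Ver i j) = X j - min (Y (i - 1)) (Y i)"

lemma nxt_in_A: "e \<in> A \<Longrightarrow> nxt e \<in> A"
  using N_pos by (cases e) (auto simp: Let_def)

lemma mod_Suc_pred [simp]: "((j - 1) mod N + 1) mod N = j mod N"
  by (simp add: mod_add_left_eq)

lemma mod_pred_Suc [simp]: "((j + 1) mod N - 1) mod N = j mod N"
  by (simp add: mod_diff_left_eq)

lemma is_hor_nxt [simp]: "is_hor (nxt e) \<longleftrightarrow> \<not> is_hor e"
  by (cases e) (auto simp: Let_def)

lemma tail_nxt: "e \<in> A \<Longrightarrow> cloth_tail N x y (nxt e) = cloth_head N x y e"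
  by (cases e) (auto simp: Let_def)

lemma eq_if_tail_eq:
  assumes "e \<in> A" "e' \<in> A" "cloth_tail N x y e = cloth_tail N x y e'" "is_hor e = is_hor e'"
  shows "e = e'"
proof (cases e)
  case (Hor i j)
  with assms show ?thesis by (cases e') (auto split: if_splits)
next
  case (Ver i j)
  then obtain i' j' where e': "e' = Ver i' j'" using assms by (cases e') auto
  have "j = j'" if "(j + 1) mod N = (j' + 1) mod N"
    using mod_pred_Suc[of j] mod_pred_Suc[of j'] that assms Ver e' by simp
  with assms Ver e' show ?thesis by (auto split: if_splits)
qed

lemma eq_if_head_eq:
  assumes "e \<in> A" "e' \<in> A" "cloth_head N x y e = cloth_head N x y e'" "is_hor e = is_hor e'"
  shows "e = e'"
proof (cases e)
  case (Hor i j)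
  with assms show ?thesis by (cases e') (auto split: if_splits)
next
  case (Ver i j)
  then obtain i' j' where e': "e' = Ver i' j'" using assms by (cases e') auto
  have "j = j'" if "(j + 1) mod N = (j' + 1) mod N"
    using mod_pred_Suc[of j] mod_pred_Suc[of j'] that assms Ver e' by simp
  with assms Ver e' show ?thesis by (auto split: if_splits)
qed

lemma eq_nxt_iff:
  assumes "e \<in> A" "e' \<in> A"
  shows "e' = nxt e \<longleftrightarrow> cloth_tail N x y e' = cloth_head N x y e \<and> is_hor e' \<noteq> is_hor e"
  using assms eq_if_tail_eq[of e' "nxt e"] nxt_in_A tail_nxt by auto

text \<open>Each vertex also has only one incoming edge of each kind, so paths can be traced
  backwards.\<close>

lemma inj_on_nxt: "inj_on nxt A"
proof (rule inj_onI)
  fix e e' assume "e \<in> A" "e' \<in> A" "nxt e = nxt e'"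
  then show "e = e'" using eq_if_head_eq[of e e'] tail_nxt is_hor_nxt by metis
qed

text \<open>At a left turn the two edges share the face on their left; at a right turn they share
  the face on their right, which is one lower than the left one.\<close>

lemma level_nxt:
  assumes "e \<in> A"
  shows "level (nxt e) = level e"
proof (cases e)
  case (Hor i j)
  have x: "X j = X (j - 1) + x j" "x j = 1 \<or> x j = -1"
    using assms Hor X_step[of j] x_sign by auto
  show ?thesis
    using x Y_step[of i] Y_step[of "i + 1"] y_sign[of i] y_sign[of "i + 1"] Hor
    by (auto simp: Let_def X_mod)
next
  case (Ver i j)
  define j' where "j' = (j + 1) mod N"
  have j': "X j' = X (j + 1)" "X (j' - 1) = X j" "0 \<le> j'" "j' < N"
    using N_pos X_mod_diff[of "j + 1" 1] by (auto simp: j'_def X_mod)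
  have x: "X j = X (j - 1) + x j" "x j = 1 \<or> x j = -1"
    and x': "X j' = X j + x j'" "x j' = 1 \<or> x j' = -1"
    using assms Ver X_step[of j] X_step[of j'] x_sign j' by auto
  show ?thesis
    using x x' j' Y_step[of i] y_sign[of i] Ver
    by (auto simp: Let_def simp flip: j'_def)
qed

section \<open>Circuits as periodic orbits of \<open>nxt\<close>\<close>

lemma circuit_iff:
  "hitomezashi_circuit N x y p \<longleftrightarrow> p \<noteq> [] \<and> set p \<subseteq> A \<and> distinct p \<and>
    (\<forall>k<length p. p ! (Suc k mod length p) = nxt (p ! k))" (is "_ \<longleftrightarrow> ?rhs")
proof
  assume circ: "hitomezashi_circuit N x y p"
  then obtain u where p: "p \<noteq> []" "set p \<subseteq> A" "distinct p" "pre_digraph.cas (cloth N x y) u p u"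
    and alt: "\<And>k. k < length p \<Longrightarrow> is_hor (p ! (Suc k mod length p)) \<noteq> is_hor (p ! k)"
    by (auto simp: hitomezashi_circuit_def pre_digraph.trail_def pre_digraph.awalk_def)
  have "p ! (Suc k mod length p) = nxt (p ! k)" if k: "k < length p" for k
  proof -
    have "cloth_tail N x y (p ! (Suc k mod length p)) = cloth_head N x y (p ! k)"
    proof (cases "Suc k = length p")
      case True
      then have "last p = p ! k" using p(1) by (metis diff_Suc_1 last_conv_nth)
      with True show ?thesis using p(4) by (simp add: cas_iff_nth[OF p(1)])
    next
      case False
      with k p(4) show ?thesis by (simp add: cas_iff_nth[OF p(1)])
    qed
    moreover have "p ! k \<in> A" "p ! (Suc k mod length p) \<in> A"
      using k p by (auto simp: subset_iff)
    ultimately show ?thesis using alt[OF k] by (simp add: eq_nxt_iff)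
  qed
  with p show ?rhs by blast
next
  assume rhs: ?rhs
  then have p: "p \<noteq> []" "set p \<subseteq> A" "distinct p"
    and nx: "\<And>k. k < length p \<Longrightarrow> p ! (Suc k mod length p) = nxt (p ! k)" by auto
  have in_A: "p ! k \<in> A" if "k < length p" for k using that p by auto
  have tl: "cloth_tail N x y (p ! (Suc k mod length p)) = cloth_head N x y (p ! k)"
    if "k < length p" for k using nx[OF that] tail_nxt[OF in_A[OF that]] by simp
  let ?u = "cloth_tail N x y (p ! 0)"
  have "cloth_head N x y (last p) = ?u"
    using tl[of "length p - 1"] p(1) by (simp add: last_conv_nth)
  moreover have "cloth_tail N x y (p ! Suc k) = cloth_head N x y (p ! k)" if "Suc k < length p" for k
    using tl[of k] that by simp
  moreover have "?u \<in> UNIV \<times> {0..<N}"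
    using in_A[of 0] p(1) N_pos by (cases "p ! 0") auto
  ultimately have "pre_digraph.trail (cloth N x y) ?u p ?u"
    using p by (simp add: pre_digraph.trail_def pre_digraph.awalk_def cas_iff_nth)
  then show "hitomezashi_circuit N x y p"
    using p(1) nx unfolding hitomezashi_circuit_def by (metis is_hor_nxt)
qed

text \<open>An injective self-map of a finite set is onto. This turns sums and images over heads
  into ones over tails.\<close>

lemma circuit_nxt_image:
  assumes "hitomezashi_circuit N x y p"
  shows "nxt ` set p = set p"
proof (rule endo_inj_surj)
  show "nxt ` set p \<subseteq> set p"
  proof
    fix e assume "e \<in> nxt ` set p"
    then obtain k where "k < length p" "e = nxt (p ! k)" by (auto simp: in_set_conv_nth)
    then have "e = p ! (Suc k mod length p)" "Suc k mod length p < length p"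
      using assms by (auto simp: circuit_iff)
    then show "e \<in> set p" by simp
  qed
  show "inj_on nxt (set p)"
    using assms inj_on_nxt by (auto simp: circuit_iff intro: inj_on_subset)
qed simp

lemma circuit_nth:
  assumes "hitomezashi_circuit N x y p" "k < length p"
  shows "p ! k = (nxt ^^ k) (p ! 0)"
  using assms(2)
proof (induction k)
  case (Suc k)
  then have "p ! Suc k = nxt (p ! k)" using assms(1) by (metis Suc_lessD circuit_iff mod_less)
  with Suc show ?case by simp
qed simp

lemma circuit_funpow_length:
  assumes "hitomezashi_circuit N x y p"
  shows "(nxt ^^ length p) (p ! 0) = p ! 0"
proof -
  obtain n where n: "length p = Suc n" using assms by (cases p) (auto simp: circuit_iff)
  then have "p ! 0 = nxt (p ! n)" using assms by (force simp: circuit_iff)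
  then show ?thesis using circuit_nth[OF assms, of n] n by simp
qed

lemma circuit_constant:
  assumes "hitomezashi_circuit N x y p" "\<And>e. e \<in> set p \<Longrightarrow> f (nxt e) = f e"
    and "e \<in> set p" "e' \<in> set p"
  shows "f e = f e'"
proof -
  have "f (p ! k) = f (p ! 0)" if "k < length p" for k
    using that
  proof (induction k)
    case (Suc k)
    then have "p ! Suc k = nxt (p ! k)" using assms(1) by (metis Suc_lessD circuit_iff mod_less)
    with Suc assms(2) show ?case by simp
  qed simp
  with assms(3,4) show ?thesis by (metis in_set_conv_nth)
qed

lemma circuit_rotate:
  assumes "hitomezashi_circuit N x y p"
  shows "hitomezashi_circuit N x y (rotate a p)"
proof -
  have "rotate a p ! (Suc k mod length p) = nxt (rotate a p ! k)" if k: "k < length p" for k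
  proof -
    have "rotate a p ! (Suc k mod length p) = p ! ((a + Suc k mod length p) mod length p)"
      using k by (intro nth_rotate mod_less_divisor) linarith
    also have "(a + Suc k mod length p) mod length p = Suc ((a + k) mod length p) mod length p"
      by (simp add: mod_simps)
    also have "p ! \<dots> = nxt (p ! ((a + k) mod length p))"
      using assms k by (auto simp: circuit_iff)
    also have "p ! ((a + k) mod length p) = rotate a p ! k" using k by (simp add: nth_rotate)
    finally show ?thesis .
  qed
  with assms show ?thesis by (simp add: circuit_iff)
qed

text \<open>Both lists follow the orbit of the same edge. If one were longer, the closing of the
  shorter one would make it repeat its first edge.\<close>

lemma circuit_eqI:
  assumes "hitomezashi_circuit N x y p" "hitomezashi_circuit N x y q" "p ! 0 = q ! 0"
  shows "p = q"
proof -
  have le: "length q \<le> length p"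
    if "hitomezashi_circuit N x y p" "hitomezashi_circuit N x y q" "p ! 0 = q ! 0" for p q
  proof (rule ccontr)
    assume "\<not> length q \<le> length p"
    then have lt: "length p < length q" by simp
    then have "q ! length p = q ! 0"
      using circuit_nth[OF that(2)] circuit_funpow_length[OF that(1)] that(3) by simp
    moreover have "p \<noteq> []" "distinct q" using that by (auto simp: circuit_iff)
    ultimately show False using lt nth_eq_iff_index_eq[of q "length p" 0] by (cases q) auto
  qed
  then have "length p = length q" using le[OF assms] le[OF assms(2,1) assms(3)[symmetric]] by simp
  with assms show ?thesis by (intro nth_equalityI) (simp_all add: circuit_nth)
qed

text \<open>Both circuits can be rotated to start at the shared edge. Uniqueness of loops rests on
  this.\<close>

lemma rotations_eqI:
  assumes "hitomezashi_circuit N x y p" "hitomezashi_circuit N x y q" "e \<in> set p" "e \<in> set q"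
  shows "rotations p = rotations q"
proof -
  have rot: "\<exists>a. rotate a p ! 0 = e" if e: "e \<in> set p" for p
  proof -
    obtain k where "k < length p" "p ! k = e" using e by (auto simp: in_set_conv_nth)
    then have "rotate k p ! 0 = e" using nth_rotate[of 0 p k] by force
    then show ?thesis ..
  qed
  obtain a b where "rotate a p ! 0 = e" "rotate b q ! 0 = e" using rot assms(3,4) by blast
  then have "rotate a p = rotate b q"
    using circuit_eqI circuit_rotate assms(1,2) by metis
  then show ?thesis using rotations_rotate[of a p] rotations_rotate[of b q] by simp
qed

text \<open>In a finite invariant set the orbit of \<open>e\<close> repeats, and by injectivity of
  \<open>nxt\<close> it returns to \<open>e\<close> itself. The least return time makes the listed
  edges distinct.\<close>

lemma circuit_through:
  assumes "e \<in> B" "finite B" "B \<subseteq> A" "\<And>e. e \<in> B \<Longrightarrow> nxt e \<in> B"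
  obtains p where "hitomezashi_circuit N x y p" "e \<in> set p" "set p \<subseteq> B"
proof -
  have orb: "(nxt ^^ k) e \<in> B" for k by (induction k) (use assms in auto)
  have cancel: "(nxt ^^ d) e = e" if "(nxt ^^ (k + d)) e = (nxt ^^ k) e" for k d
    using that
  proof (induction k)
    case (Suc k)
    then have "nxt ((nxt ^^ (k + d)) e) = nxt ((nxt ^^ k) e)" by simp
    then show ?case using Suc.IH inj_on_nxt orb assms(3) by (auto dest: inj_onD)
  qed simp
  have "\<not> inj (\<lambda>k. (nxt ^^ k) e)"
    using orb \<open>finite B\<close> by (meson finite_subset finite_imageD image_subsetI infinite_UNIV_nat)
  then obtain k l where "k \<noteq> l" "(nxt ^^ k) e = (nxt ^^ l) e" unfolding inj_def by blast
  then obtain k l where "k < l" "(nxt ^^ k) e = (nxt ^^ l) e"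
    by (cases k l rule: linorder_cases) auto
  then have "(nxt ^^ (l - k)) e = e" "0 < l - k" using cancel[of k "l - k"] by auto
  then have ex: "\<exists>n. 0 < n \<and> (nxt ^^ n) e = e" by blast
  define n where "n = (LEAST n. 0 < n \<and> (nxt ^^ n) e = e)"
  have n: "0 < n" "(nxt ^^ n) e = e" using LeastI_ex[OF ex] by (auto simp: n_def)
  have least: "n \<le> d" if "0 < d" "(nxt ^^ d) e = e" for d
    using that by (auto simp: n_def intro: Least_le)
  have neq: "(nxt ^^ k) e \<noteq> (nxt ^^ l) e" if "k < l" "l < n" for k l
    using cancel[of k "l - k"] least[of "l - k"] that by auto
  define p where "p = map (\<lambda>k. (nxt ^^ k) e) [0..<n]"
  have "k = l" if "k < n" "l < n" "(nxt ^^ k) e = (nxt ^^ l) e" for k l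
    using neq[of k l] neq[of l k] that by (cases k l rule: linorder_cases) auto
  then have "distinct p" by (auto simp: p_def distinct_map inj_on_def)
  moreover have "p ! (Suc k mod n) = nxt (p ! k)" if "k < n" for k
    using that n by (cases "Suc k = n") (auto simp: p_def)
  moreover have "set p \<subseteq> B" using orb by (auto simp: p_def)
  ultimately have "hitomezashi_circuit N x y p"
    using n assms(3) by (auto simp: circuit_iff p_def)
  moreover have "e \<in> set p" using n by (force simp: p_def)
  ultimately show thesis using \<open>set p \<subseteq> B\<close> that by blast
qed

section \<open>The homology class as a winding number\<close>

fun vsign :: "edge \<Rightarrow> int" where
  "vsign (Hor i j) = 0"
| "vsign (Ver i j) = y i"

text \<open>Signed crossing of the line between rows \<open>j0\<close> and \<open>j0 + 1\<close>,
  which runs along the whole cylinder; summed over a circuit it is the winding number.\<close>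

fun row_sign :: "int \<Rightarrow> edge \<Rightarrow> int" where
  "row_sign j0 (Hor i j) = 0"
| "row_sign j0 (Ver i j) = (if j = j0 then y i else 0)"

lemma delta_y_eq: "delta_y y (rotations p) = (\<Sum>e\<in>set p. vsign e)"
proof -
  have card: "int (card {e \<in> S. P e}) = (\<Sum>e\<in>S. if P e then 1 else 0)" if "finite S" for S and P :: "edge \<Rightarrow> bool"
    using that by (simp add: sum.If_cases Int_def)
  have "(if \<exists>i j. e = Ver i j \<and> y i = 1 then 1 else 0) -
      (if \<exists>i j. e = Ver i j \<and> y i = -1 then 1 else 0) = vsign e" for e
    by (cases e) (use y_sign in auto)
  then show ?thesis
    unfolding delta_y_def loop_edges_rotations
    by (simp only: card[OF finite_set] flip: sum_subtractf)
qed

text \<open>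
  The vertical coordinate, read off in \<open>{0..<N}\<close> after cutting the cylinder open above row \<open>j0\<close>,
  changes by \<open>vsign e - N * row_sign j0 e\<close> along \<open>e\<close>, and these changes cancel around a circuit.
\<close>

lemma circuit_vsign:
  assumes circ: "hitomezashi_circuit N x y p" and j0: "0 \<le> j0" "j0 < N"
  shows "(\<Sum>e\<in>set p. vsign e) = N * (\<Sum>e\<in>set p. row_sign j0 e)"
proof -
  \<comment> \<open>The shift by \<open>j0 + 1\<close> puts the jump between \<open>N - 1\<close>
    and 0 exactly on the edges \<open>Ver i j0\<close>.\<close>
  define f :: "int \<times> int \<Rightarrow> int" where "f w = (snd w - j0 - 1) mod N" for w
  let ?t = "cloth_tail N x y" and ?h = "cloth_head N x y"
  have sub: "set p \<subseteq> A" using circ by (simp add: circuit_iff)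
  have "(\<Sum>e\<in>set p. f (?h e)) = (\<Sum>e\<in>set p. f (?t (nxt e)))"
    using sub by (intro sum.cong) (auto simp: tail_nxt)
  also have "\<dots> = (\<Sum>e\<in>nxt ` set p. f (?t e))"
    using inj_on_subset[OF inj_on_nxt sub] by (simp add: sum.reindex)
  finally have "(\<Sum>e\<in>set p. f (?h e) - f (?t e)) = 0"
    by (simp add: circuit_nxt_image[OF circ] sum_subtractf)
  moreover have "f (?h e) - f (?t e) = vsign e - N * row_sign j0 e" if "e \<in> A" for e
  proof (cases e)
    case (Ver i j)
    have *: "(j - j0) mod N - (j - j0 - 1) mod N = (if j = j0 then 1 - N else 1)"
    proof -
      have "(j - j0) mod N = (if j \<ge> j0 then j - j0 else j - j0 + N)"
        "(j - j0 - 1) mod N = (if j - 1 \<ge> j0 then j - j0 - 1 else j - j0 - 1 + N)"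
        using that Ver j0 by (auto intro: int_mod_pos_eq[of _ _ "-1"])
      then show ?thesis by auto
    qed
    have "((j + 1) mod N - j0 - 1) mod N = (j - j0) mod N"
      using mod_diff_left_eq[of "j + 1" N "j0 + 1"] by (simp add: algebra_simps)
    with * y_sign[of i] show ?thesis
      by (auto simp: f_def Ver)
  qed (auto simp: f_def)
  ultimately have "(\<Sum>e\<in>set p. vsign e - N * row_sign j0 e) = 0"
    using sub by (metis (no_types, lifting) subsetD sum.cong)
  then show ?thesis by (simp add: sum_subtractf sum_distrib_left)
qed

section \<open>Bounding cylinders\<close>

lemma circuit_verts:
  assumes "hitomezashi_circuit N x y p"
  shows "loop_verts N x y (rotations p) = cloth_tail N x y ` set p"
proof -
  have "cloth_head N x y ` set p = (\<lambda>e. cloth_tail N x y (nxt e)) ` set p"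
    using assms by (intro image_cong) (auto simp: circuit_iff subset_iff tail_nxt)
  also have "\<dots> = cloth_tail N x y ` nxt ` set p" by (simp add: image_image)
  finally show ?thesis
    by (simp add: loop_verts_def circuit_nxt_image[OF assms])
qed

lemma snd_cloth_tail: "e \<in> A \<Longrightarrow> snd (cloth_tail N x y e) \<in> {0..<N}"
  using N_pos by (cases e) auto

text \<open>Every head is the tail of the next edge, so tails suffice. Both end columns are visited,
  since otherwise the cylinder could lose a column.\<close>

lemma bounding_sequence_iff:
  assumes "hitomezashi_circuit N x y p"
  shows "bounding_sequence N x y (rotations p) m M \<longleftrightarrow>
    (\<forall>e\<in>set p. m \<le> fst (cloth_tail N x y e) \<and> fst (cloth_tail N x y e) \<le> M) \<and>
    (\<exists>e\<in>set p. fst (cloth_tail N x y e) = m) \<and> (\<exists>e\<in>set p. fst (cloth_tail N x y e) = M)"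
    (is "?lhs \<longleftrightarrow> ?rhs")
proof -
  define c where "c e = fst (cloth_tail N x y e)" for e
  have p: "p \<noteq> []" "set p \<subseteq> A" using assms by (auto simp: circuit_iff)
  have sub: "loop_verts N x y (rotations p) \<subseteq> cylinder N a b \<longleftrightarrow> (\<forall>e\<in>set p. a \<le> c e \<and> c e \<le> b)"
    for a b
  proof -
    have "snd (cloth_tail N x y e) \<in> {0..<N}" if "e \<in> set p" for e
      using that p(2) snd_cloth_tail by blast
    then show ?thesis
      unfolding circuit_verts[OF assms] cylinder_def image_subset_iff mem_Times_iff c_def
      by auto
  qed
  have cyl: "cylinder N a b \<subseteq> cylinder N a' b' \<longleftrightarrow> a' \<le> a \<and> b \<le> b'" if "a \<le> b" for a b a' b'
    using that N_pos by (auto simp: cylinder_def times_subset_iff)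
  have "?lhs \<longleftrightarrow> (\<forall>e\<in>set p. m \<le> c e \<and> c e \<le> M) \<and> (\<exists>e\<in>set p. c e = m) \<and> (\<exists>e\<in>set p. c e = M)"
  proof
    assume l: ?lhs
    then have le: "m \<le> M" and bd: "\<forall>e\<in>set p. m \<le> c e \<and> c e \<le> M"
      and mn: "\<And>a b. \<forall>e\<in>set p. a \<le> c e \<and> c e \<le> b \<Longrightarrow> a \<le> m \<and> M \<le> b"
      unfolding bounding_sequence_def sub by (auto simp: cyl) blast+
    have "\<exists>e\<in>set p. c e = m"
    proof (rule ccontr)
      assume "\<not> ?thesis"
      then have "\<forall>e\<in>set p. m + 1 \<le> c e \<and> c e \<le> M" using bd by force
      from mn[OF this] show False by simp
    qed
    moreover have "\<exists>e\<in>set p. c e = M"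
    proof (rule ccontr)
      assume "\<not> ?thesis"
      then have "\<forall>e\<in>set p. m \<le> c e \<and> c e \<le> M - 1" using bd by force
      from mn[OF this] show False by simp
    qed
    ultimately show "(\<forall>e\<in>set p. m \<le> c e \<and> c e \<le> M) \<and> (\<exists>e\<in>set p. c e = m) \<and> (\<exists>e\<in>set p. c e = M)"
      using bd by blast
  next
    assume r: "(\<forall>e\<in>set p. m \<le> c e \<and> c e \<le> M) \<and> (\<exists>e\<in>set p. c e = m) \<and> (\<exists>e\<in>set p. c e = M)"
    then have "m \<le> M" by force
    with r show ?lhs by (auto simp: bounding_sequence_def sub cyl)
  qed
  then show ?thesis by (simp add: c_def)
qed

lemma bounding_sequence_exists:
  assumes "hitomezashi_circuit N x y p"
  obtains m M where "bounding_sequence N x y (rotations p) m M"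
proof -
  let ?C = "(\<lambda>e. fst (cloth_tail N x y e)) ` set p"
  have "finite ?C" "?C \<noteq> {}" using assms by (auto simp: circuit_iff)
  then have "Min ?C \<in> ?C" "Max ?C \<in> ?C" "\<forall>c\<in>?C. Min ?C \<le> c \<and> c \<le> Max ?C" by auto
  then have "bounding_sequence N x y (rotations p) (Min ?C) (Max ?C)"
    unfolding bounding_sequence_iff[OF assms] by force
  then show thesis by (rule that)
qed

lemma bounding_columns:
  assumes circ: "hitomezashi_circuit N x y p"
    and bnd: "bounding_sequence N x y (rotations p) m M"
  shows "Hor i j \<in> set p \<Longrightarrow> m \<le> i \<and> i < M" and "Ver i j \<in> set p \<Longrightarrow> m \<le> i \<and> i \<le> M"
proof -
  have t: "m \<le> fst (cloth_tail N x y e) \<and> fst (cloth_tail N x y e) \<le> M" if "e \<in> set p" for e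
    using that bnd by (auto simp: bounding_sequence_iff[OF circ])
  have h: "m \<le> fst (cloth_head N x y e) \<and> fst (cloth_head N x y e) \<le> M" if "e \<in> set p" for e
  proof -
    have "nxt e \<in> set p" using that circuit_nxt_image[OF circ] by blast
    moreover have "e \<in> A" using that circ by (auto simp: circuit_iff)
    ultimately show ?thesis using t[of "nxt e"] by (simp add: tail_nxt)
  qed
  show "Hor i j \<in> set p \<Longrightarrow> m \<le> i \<and> i < M" using t[of "Hor i j"] h[of "Hor i j"]
    by (auto split: if_splits)
  show "Ver i j \<in> set p \<Longrightarrow> m \<le> i \<and> i \<le> M" using t[of "Ver i j"]
    by (auto split: if_splits)
qed

text \<open>Without a horizontal edge over \<open>f\<close> the circuit would stay on one side, yet
  columns \<open>m\<close> and \<open>M\<close> lie on different sides.\<close>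

lemma circuit_crosses_column:
  assumes circ: "hitomezashi_circuit N x y p"
    and bnd: "bounding_sequence N x y (rotations p) m M"
    and "m \<le> f" "f < M"
  obtains j where "Hor f j \<in> set p"
proof -
  have "\<exists>j. Hor f j \<in> set p"
  proof (rule ccontr)
    assume no: "\<not> ?thesis"
    let ?side = "\<lambda>e. fst (cloth_tail N x y e) \<le> f"
    have "?side (nxt e) = ?side e" if e: "e \<in> set p" for e
    proof -
      have "e \<in> A" using circ e by (auto simp: circuit_iff)
      then have "fst (cloth_tail N x y (nxt e)) = fst (cloth_head N x y e)" by (simp add: tail_nxt)
      with e no show ?thesis
        by (cases rule: edge.exhaust[of e]) (force simp: order.order_iff_strict)+
    qed
    note const = circuit_constant[OF circ, of ?side, OF this]
    obtain e e' where "e \<in> set p" "fst (cloth_tail N x y e) = m"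
      "e' \<in> set p" "fst (cloth_tail N x y e') = M"
      using bnd unfolding bounding_sequence_iff[OF circ] by blast
    then show False using const[of e e'] assms(3,4) by simp
  qed
  then show thesis using that by blast
qed

lemma homology_class_eq_iff:
  "homology_class N y L = of_int k \<longleftrightarrow> delta_y y L = N * k"
proof -
  have "homology_class N y L = of_int k \<longleftrightarrow> rat_of_int (delta_y y L) = of_int (N * k)"
    using N_pos by (auto simp: homology_class_def field_simps)
  then show ?thesis by (simp only: of_int_eq_iff)
qed

section \<open>Circuits of nonzero class, with \<open>u\<close> and \<open>v\<close> rows of minimal
  and maximal \<open>X\<close>\<close>

context
  fixes u v :: int
  assumes u: "0 \<le> u" "u < N" and v: "0 \<le> v" "v < N"
    and X_min: "X u \<le> X j" and X_max: "X j \<le> X v"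
begin

text \<open>Adjacent values of \<open>X\<close> differ, so the larger is above the minimum. This
  makes the lower bound on \<open>Y\<close> strict.\<close>

lemma X_less_max_adjacent:
  assumes "0 \<le> j" "j < N"
  shows "X u < max (X (j - 1)) (X j)"
  using X_step[of j] x_sign[OF assms] X_min[of j] X_min[of "j - 1"] assms by auto

lemma row_sign_nonzero:
  assumes "(\<Sum>e\<in>S. row_sign j e) \<noteq> 0"
  obtains i where "Ver i j \<in> S"
proof -
  obtain e where "e \<in> S" "row_sign j e \<noteq> 0" using assms by (meson sum.neutral)
  then show thesis using that by (cases e) (auto split: if_splits)
qed

text \<open>The alternatives are the classes 1 and -1, where \<open>Y\<close> rises or falls across
  the cylinder. The edge in row \<open>u\<close> is recorded for the uniqueness proof.\<close>

lemma spanning_circuit: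
  assumes circ: "hitomezashi_circuit N x y p" and nz: "(\<Sum>e\<in>set p. vsign e) \<noteq> 0"
    and bnd: "bounding_sequence N x y (rotations p) m M"
    and lev: "e \<in> set p" "level e = c"
  shows "(\<forall>f. m \<le> f \<and> f < M \<longrightarrow> X u - c < Y f \<and> Y f < X v - c + 1) \<and>
    ((Y (m - 1) = X u - c \<and> Y M = X v - c + 1 \<and> Ver m u \<in> set p \<and> (\<Sum>e\<in>set p. vsign e) = N) \<or>
     (Y (m - 1) = X v - c + 1 \<and> Y M = X u - c \<and> Ver M u \<in> set p \<and> (\<Sum>e\<in>set p. vsign e) = - N))"
proof -
  have sub: "set p \<subseteq> A" using circ by (simp add: circuit_iff)
  have level: "level e' = c" if "e' \<in> set p" for e'
    using circuit_constant[OF circ, of level e' e] that lev sub level_nxt by auto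
  have inside: "X u - c < Y f \<and> Y f < X v - c + 1" if f: "m \<le> f" "f < M" for f
  proof -
    \<comment> \<open>The level of this edge is \<open>max (X (j - 1)) (X j) - Y f\<close>, which is
      above \<open>X u - Y f\<close> and at most \<open>X v - Y f\<close>.\<close>
    obtain j where j: "Hor f j \<in> set p" using circuit_crosses_column[OF circ bnd f] .
    then have "0 \<le> j" "j < N" using sub by auto
    then show ?thesis
      using level[OF j] X_less_max_adjacent[of j] X_max[of j] X_max[of "j - 1"] by auto
  qed
  note cols = bounding_columns[OF circ bnd]
  have "m \<noteq> M"
  proof
    assume "m = M"
    then have "\<not> is_hor e'" if "e' \<in> set p" for e' using that cols(1) by (cases rule: edge.exhaust[of e']) force+
    moreover have "nxt e \<in> set p" using circuit_nxt_image[OF circ] lev by blast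
    ultimately show False using lev(1) is_hor_nxt by blast
  qed
  have ystep: "Y i = Y (i - 1) + 1 \<and> y i = 1 \<or> Y i = Y (i - 1) - 1 \<and> y i = -1" for i
    using Y_step[of i] y_sign[of i] by auto
  have row: "(\<Sum>e\<in>set p. row_sign j e) \<noteq> 0" if "0 \<le> j" "j < N" for j
    using circuit_vsign[OF circ that] nz by auto
  \<comment> \<open>Crossing row \<open>u\<close> needs an adjacent value of \<open>Y\<close> equal
    to \<open>X u - c\<close>, which \<open>inside\<close> excludes from \<open>m\<close> to
    \<open>M - 1\<close>; so the crossing is in an end column.\<close>
  have at_u: "i = m \<and> Y (m - 1) = X u - c \<and> y m = 1 \<or> i = M \<and> Y M = X u - c \<and> y M = -1"
    if i: "Ver i u \<in> set p" for i
  proof -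
    have "m \<le> i" "i \<le> M" "X u - c = min (Y (i - 1)) (Y i)" using cols(2)[OF i] level[OF i] by auto
    then show ?thesis using inside[of i] inside[of "i - 1"] ystep[of i] \<open>m \<noteq> M\<close> by force
  qed
  \<comment> \<open>Here the smaller adjacent value of \<open>Y\<close> is \<open>X v - c\<close>,
    so the larger is the excluded upper bound.\<close>
  have at_v: "i = m \<and> Y (m - 1) = X v - c + 1 \<or> i = M \<and> Y M = X v - c + 1"
    if i: "Ver i v \<in> set p" for i
  proof -
    have "m \<le> i" "i \<le> M" "X v - c = min (Y (i - 1)) (Y i)" using cols(2)[OF i] level[OF i] by auto
    then show ?thesis using inside[of i] inside[of "i - 1"] ystep[of i] \<open>m \<noteq> M\<close> by force
  qed
  obtain iu where iu: "Ver iu u \<in> set p" using row_sign_nonzero[OF row[OF u]] .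
  obtain iv where iv: "Ver iv v \<in> set p" using row_sign_nonzero[OF row[OF v]] .
  \<comment> \<open>The crossings of rows \<open>u\<close> and \<open>v\<close> need different
    values of \<open>Y\<close>, hence lie at opposite ends.\<close>
  have ends: "Y (m - 1) = X u - c \<and> Y M = X v - c + 1 \<and> iu = m \<and> y iu = 1 \<or>
      Y (m - 1) = X v - c + 1 \<and> Y M = X u - c \<and> iu = M \<and> y iu = -1"
    using at_u[OF iu] at_v[OF iv] X_min[of v] by auto
  \<comment> \<open>At the opposite end \<open>Y\<close> takes the upper bound, so row
    \<open>u\<close> is crossed only once and that sign is the winding number.\<close>
  have "row_sign u e' = 0" if "e' \<in> set p - {Ver iu u}" for e'
    using that at_u ends X_min[of v] by (cases rule: edge.exhaust[of e']) auto
  then have "(\<Sum>e\<in>set p. row_sign u e) = y iu"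
    using sum.remove[OF finite_set iu, of "row_sign u"] by simp
  then have "(\<Sum>e\<in>set p. vsign e) = N * y iu" using circuit_vsign[OF circ u] by simp
  with ends iu inside show ?thesis by auto
qed

text \<open>The path through row \<open>u\<close> stays among the finitely many edges of level
  \<open>c\<close> in the cylinder, so it closes up. Its single crossing of row \<open>u\<close>
  gives a nonzero class, and the bounds on \<open>Y\<close> leave no smaller cylinder.\<close>

lemma spanning_circuit_exists:
  assumes "m \<le> M" and inside: "\<And>f. m \<le> f \<Longrightarrow> f < M \<Longrightarrow> X u - c < Y f \<and> Y f < X v - c + 1"
    and ends: "Y (m - 1) = X u - c \<and> Y M = X v - c + 1 \<or> Y (m - 1) = X v - c + 1 \<and> Y M = X u - c"
  obtains p where "hitomezashi_circuit N x y p" "(\<Sum>e\<in>set p. vsign e) \<noteq> 0"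
    "bounding_sequence N x y (rotations p) m M"
proof -
  \<comment> \<open>The end where \<open>Y\<close> meets its lower bound, the only column of the
    cylinder where level \<open>c\<close> can cross row \<open>u\<close>.\<close>
  define i0 where "i0 = (if Y (m - 1) = X u - c then m else M)"
  have uv: "X u \<le> X v" by (rule X_min)
  have ystep: "Y i = Y (i - 1) + 1 \<and> y i = 1 \<or> Y i = Y (i - 1) - 1 \<and> y i = -1" for i
    using Y_step[of i] y_sign[of i] by auto
  define B where "B = {e \<in> A. level e = c} \<inter>
    (case_prod Hor ` ({m..<M} \<times> {0..<N}) \<union> case_prod Ver ` ({m..M} \<times> {0..<N}))"
  have Hor_B: "Hor i j \<in> B \<longleftrightarrow> m \<le> i \<and> i < M \<and> 0 \<le> j \<and> j < N \<and> level (Hor i j) = c" for i j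
    by (auto simp: B_def)
  have Ver_B: "Ver i j \<in> B \<longleftrightarrow> m \<le> i \<and> i \<le> M \<and> 0 \<le> j \<and> j < N \<and> level (Ver i j) = c" for i j
    by (auto simp: B_def)
  have only: "i = i0" if "m \<le> i" "i \<le> M" "min (Y (i - 1)) (Y i) = X u - c" for i
    using that inside[of i] inside[of "i - 1"] ends uv ystep[of i]
    by (cases "i = m"; cases "i = M") (auto simp: i0_def)
  have lev0: "min (Y (i0 - 1)) (Y i0) = X u - c"
    using inside[of m] inside[of "M - 1"] ends uv \<open>m \<le> M\<close> ystep[of i0]
    by (cases "m = M") (auto simp: i0_def split: if_splits)
  have i0: "m \<le> i0" "i0 \<le> M" using \<open>m \<le> M\<close> by (auto simp: i0_def)
  have "Ver i0 u \<in> B" using lev0 i0 u by (simp add: Ver_B)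
  moreover have "finite B" by (simp add: B_def)
  moreover have "B \<subseteq> A" by (auto simp: B_def)
  moreover have "nxt e \<in> B" if e: "e \<in> B" for e
  proof -
    have *: "nxt e \<in> A" "level (nxt e) = c"
      using e nxt_in_A level_nxt by (auto simp: B_def)
    show ?thesis
    proof (cases e)
      case (Hor i j)
      with e * show ?thesis by (auto simp: Hor_B Ver_B Let_def simp del: level.simps)
    next
      case (Ver i j)
      obtain i' j' where n: "nxt e = Hor i' j'" "i' = i \<or> i' = i - 1" by (auto simp: Ver Let_def)
      \<comment> \<open>Only a horizontal edge over \<open>m - 1\<close> or \<open>M\<close> would
        leave the cylinder, but there \<open>Y\<close> equals a bound that level \<open>c\<close>
        excludes.\<close>
      have "0 \<le> j'" "j' < N" using * n by auto
      then have "X u - c < Y i'" "Y i' < X v - c + 1"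
        using *(2) X_less_max_adjacent[of j'] X_max[of j'] X_max[of "j' - 1"] by (auto simp: n(1))
      then have "i' \<noteq> m - 1" "i' \<noteq> M" using ends by auto
      with * n e Ver show ?thesis by (auto simp: Hor_B Ver_B simp del: level.simps)
    qed
  qed
  ultimately obtain p where p: "hitomezashi_circuit N x y p" "Ver i0 u \<in> set p" "set p \<subseteq> B"
    by (rule circuit_through)
  have "row_sign u e = 0" if "e \<in> set p - {Ver i0 u}" for e
  proof (cases e)
    case (Ver i j)
    then show ?thesis using that p(3) only[of i] Ver_B[of i j] by auto
  qed simp
  then have "(\<Sum>e\<in>set p. row_sign u e) = y i0"
    using sum.remove[OF finite_set p(2), of "row_sign u"] by simp
  then have nz: "(\<Sum>e\<in>set p. vsign e) \<noteq> 0"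
    using circuit_vsign[OF p(1) u] N_pos y_sign[of i0] by auto
  obtain m' M' where bnd: "bounding_sequence N x y (rotations p) m' M'"
    using bounding_sequence_exists[OF p(1)] .
  have "level (Ver i0 u) = c" using lev0 by simp
  from spanning_circuit[OF p(1) nz bnd p(2) this]
  have new: "Y (m' - 1) = X u - c \<and> Y M' = X v - c + 1 \<or> Y (m' - 1) = X v - c + 1 \<and> Y M' = X u - c"
    by blast
  have "m \<le> fst (cloth_tail N x y e) \<and> fst (cloth_tail N x y e) \<le> M" if "e \<in> set p" for e
    using that p(3) by (cases rule: edge.exhaust[of e]) (auto simp: Hor_B Ver_B dest!: subsetD)
  then have le: "m \<le> m'" "M' \<le> M" "m' \<le> M'"
    using bnd unfolding bounding_sequence_iff[OF p(1)] by fastforce+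
  \<comment> \<open>A smaller cylinder would have one of the two bounds attained at an index where
    \<open>inside\<close> forbids it.\<close>
  have "m' = m"
  proof (rule ccontr)
    assume "m' \<noteq> m"
    then show False using new le inside[of "m' - 1"] by auto
  qed
  moreover have "M' = M"
  proof (rule ccontr)
    assume "M' \<noteq> M"
    then show False using new le inside[of M'] by auto
  qed
  ultimately show thesis using that p(1) nz bnd by blast
qed

section \<open>Minimal overflow and the loops of class 1 and -1\<close>

text \<open>Common form of both overflow conditions: \<open>s\<close> stands for the homology class
  and \<open>c\<close> for the level of the loop.\<close>

definition spans :: "int \<Rightarrow> int \<Rightarrow> int \<Rightarrow> bool" where
  "spans s m M \<longleftrightarrow> (\<exists>c. (\<forall>f. m \<le> f \<and> f < M \<longrightarrow> X u - c < Y f \<and> Y f < X v - c + 1) \<and>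
    (if s = 1 then Y (m - 1) = X u - c \<and> Y M = X v - c + 1
     else Y (m - 1) = X v - c + 1 \<and> Y M = X u - c))"

lemma min_pos_overflowing_iff_spans:
  assumes "m \<le> M" and r: "sum_range N x = X v - X u"
  shows "min_pos_overflowing N x y m M \<longleftrightarrow> spans 1 m M"
proof -
  have step: "\<bar>Y i - Y (i - 1)\<bar> \<le> 1" for i using Y_step[of i] y_sign[of i] by auto
  have "min_pos_overflowing N x y m M \<longleftrightarrow> Y M = Y (m - 1) + (X v - X u) + 1 \<and>
      (\<forall>f. m \<le> f \<and> f < M \<longrightarrow> Y (m - 1) < Y f \<and> Y f < Y M)"
    using minimal_rise_iff[of Y, OF step \<open>m \<le> M\<close>, of "X v - X u"] X_min[of v]
    by (simp add: min_pos_overflowing_def pos_overflowing_def Sigma_sum_y r)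
  also have "\<dots> \<longleftrightarrow> spans 1 m M"
    \<comment> \<open>The left end sits at the lower bound \<open>X u - c\<close>, which forces this
      \<open>c\<close>.\<close>
    unfolding spans_def by (auto intro!: exI[of _ "X u - Y (m - 1)"])
  finally show ?thesis .
qed

text \<open>Negating \<open>Y\<close> turns the fall into a rise; the lower bound is now met at
  \<open>M\<close>, which gives the witness for \<open>c\<close>.\<close>

lemma min_neg_overflowing_iff_spans:
  assumes "m \<le> M" and r: "sum_range N x = X v - X u"
  shows "min_neg_overflowing N x y m M \<longleftrightarrow> spans (- 1) m M"
proof -
  have step: "\<bar>- Y i - - Y (i - 1)\<bar> \<le> 1" for i using Y_step[of i] y_sign[of i] by auto
  have neg: "neg_overflowing N x y a b \<longleftrightarrow> - Y b - - Y (a - 1) > X v - X u" for a b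
    by (auto simp: neg_overflowing_def Sigma_sum_y r)
  have "min_neg_overflowing N x y m M \<longleftrightarrow> - Y M = - Y (m - 1) + (X v - X u) + 1 \<and>
      (\<forall>f. m \<le> f \<and> f < M \<longrightarrow> - Y (m - 1) < - Y f \<and> - Y f < - Y M)"
    unfolding min_neg_overflowing_def neg
    by (rule minimal_rise_iff[of "\<lambda>i. - Y i", OF step \<open>m \<le> M\<close>]) (use X_min[of v] in simp)
  also have "\<dots> \<longleftrightarrow> spans (- 1) m M"
    unfolding spans_def by (auto intro!: exI[of _ "X u - Y M"])
  finally show ?thesis .
qed

text \<open>The predicate \<open>mo\<close> stands for either overflow condition, so both signs are
  treated at once.\<close>

lemma loops_of_class:
  assumes s: "s = 1 \<or> s = - 1" and mo: "\<And>m M. m \<le> M \<Longrightarrow> mo m M \<longleftrightarrow> spans s m M"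
  shows "\<And>L. hitomezashi_loop N x y L \<Longrightarrow> homology_class N y L = of_int s \<Longrightarrow>
      \<exists>m M. bounding_sequence N x y L m M \<and> mo m M"
    and "\<And>m M. m \<le> M \<Longrightarrow> mo m M \<Longrightarrow>
      \<exists>!L. hitomezashi_loop N x y L \<and> homology_class N y L = of_int s \<and> bounding_sequence N x y L m M"
proof -
  have cls: "homology_class N y (rotations p) = of_int s \<longleftrightarrow> (\<Sum>e\<in>set p. vsign e) = N * s" for p
    unfolding homology_class_eq_iff delta_y_eq ..
  \<comment> \<open>Beyond \<open>spans\<close>, this exhibits an edge that depends only on
    \<open>s\<close>, \<open>m\<close> and \<open>M\<close>, so two loops with the same data share
    it.\<close>
  have span: "\<exists>c. (\<forall>f. m \<le> f \<and> f < M \<longrightarrow> X u - c < Y f \<and> Y f < X v - c + 1) \<and>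
      (if s = 1 then Y (m - 1) = X u - c \<and> Y M = X v - c + 1
       else Y (m - 1) = X v - c + 1 \<and> Y M = X u - c) \<and> Ver (if s = 1 then m else M) u \<in> set p"
    if circ: "hitomezashi_circuit N x y p" and sum: "(\<Sum>e\<in>set p. vsign e) = N * s"
      and bnd: "bounding_sequence N x y (rotations p) m M" for p m M
  proof -
    have "(\<Sum>e\<in>set p. vsign e) \<noteq> 0" using s N_pos sum by auto
    moreover obtain e where "e \<in> set p" using circ by (cases p) (auto simp: circuit_iff)
    ultimately have "(\<forall>f. m \<le> f \<and> f < M \<longrightarrow> X u - level e < Y f \<and> Y f < X v - level e + 1) \<and>
      (if s = 1 then Y (m - 1) = X u - level e \<and> Y M = X v - level e + 1
       else Y (m - 1) = X v - level e + 1 \<and> Y M = X u - level e) \<and>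
      Ver (if s = 1 then m else M) u \<in> set p"
      using spanning_circuit[OF circ _ bnd _ refl, of e] sum s N_pos by auto
    then show ?thesis by blast
  qed
  show "\<exists>m M. bounding_sequence N x y L m M \<and> mo m M"
    if loop: "hitomezashi_loop N x y L" and L1: "homology_class N y L = of_int s" for L
  proof -
    obtain p where p: "hitomezashi_circuit N x y p" and L: "L = rotations p"
      using loop unfolding hitomezashi_loop_iff by blast
    obtain m M where bnd: "bounding_sequence N x y L m M"
      using bounding_sequence_exists[OF p] unfolding L .
    moreover have "spans s m M"
      using span[OF p _ bnd[unfolded L]] L1 unfolding L cls spans_def by blast
    moreover have "m \<le> M" using bnd by (simp add: bounding_sequence_def)
    ultimately show ?thesis using mo by blast
  qed
  show "\<exists>!L. hitomezashi_loop N x y L \<and> homology_class N y L = of_int s \<and> bounding_sequence N x y L m M"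
    if "m \<le> M" and min: "mo m M" for m M
  proof (rule ex_ex1I)
    obtain c where inside: "\<And>f. m \<le> f \<Longrightarrow> f < M \<Longrightarrow> X u - c < Y f \<and> Y f < X v - c + 1"
      and ends: "if s = 1 then Y (m - 1) = X u - c \<and> Y M = X v - c + 1
        else Y (m - 1) = X v - c + 1 \<and> Y M = X u - c"
      using min unfolding mo[OF \<open>m \<le> M\<close>] spans_def by blast
    then have "Y (m - 1) = X u - c \<and> Y M = X v - c + 1 \<or> Y (m - 1) = X v - c + 1 \<and> Y M = X u - c"
      by (auto split: if_splits)
    from spanning_circuit_exists[OF \<open>m \<le> M\<close> inside this]
    obtain p where p: "hitomezashi_circuit N x y p" "(\<Sum>e\<in>set p. vsign e) \<noteq> 0"
      "bounding_sequence N x y (rotations p) m M" by blast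
    obtain e where e: "e \<in> set p" using p(1) by (cases p) (auto simp: circuit_iff)
    \<comment> \<open>The circuit is not known to have level \<open>c\<close>, but whether
      \<open>Y\<close> rises or falls from \<open>m - 1\<close> to \<open>M\<close> already decides
      the sign.\<close>
    have "(\<Sum>e\<in>set p. vsign e) = N * s"
      using spanning_circuit[OF p e refl] ends s X_min[of v] by (auto split: if_splits)
    with p show "\<exists>L. hitomezashi_loop N x y L \<and> homology_class N y L = of_int s \<and>
        bounding_sequence N x y L m M"
      unfolding hitomezashi_loop_iff using cls[of p] by blast
  next
    fix L L'
    assume "hitomezashi_loop N x y L \<and> homology_class N y L = of_int s \<and> bounding_sequence N x y L m M"
      and "hitomezashi_loop N x y L' \<and> homology_class N y L' = of_int s \<and> bounding_sequence N x y L' m M"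
    then obtain p q where p: "hitomezashi_circuit N x y p" "L = rotations p"
        "homology_class N y L = of_int s" "bounding_sequence N x y L m M"
      and q: "hitomezashi_circuit N x y q" "L' = rotations q"
        "homology_class N y L' = of_int s" "bounding_sequence N x y L' m M"
      unfolding hitomezashi_loop_iff by blast
    have "Ver (if s = 1 then m else M) u \<in> set p" "Ver (if s = 1 then m else M) u \<in> set q"
      using span[OF p(1)] span[OF q(1)] p(3,4) q(3,4) unfolding p(2) q(2) cls by blast+
    then show "L = L'" using rotations_eqI[OF p(1) q(1)] p(2) q(2) by simp
  qed
qed

end

end

theorem theorem1p1:
  fixes N :: int and x y :: "int \<Rightarrow> int"
  assumes "N > 0"
    and "\<forall>j\<in>{0..<N}. x j \<in> {-1, 1}"
    and "\<forall>i. y i \<in> {-1, 1}"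
    and "total_sum N x = 0"
  shows
    "(\<forall>L. hitomezashi_loop N x y L \<and> homology_class N y L = 1 \<longrightarrow>
        (\<exists>m M. bounding_sequence N x y L m M \<and> min_pos_overflowing N x y m M)) \<and>
     (\<forall>m M. m \<le> M \<and> min_pos_overflowing N x y m M \<longrightarrow>
        (\<exists>!L. hitomezashi_loop N x y L \<and> homology_class N y L = 1 \<and>
              bounding_sequence N x y L m M)) \<and>
     (\<forall>L. hitomezashi_loop N x y L \<and> homology_class N y L = - 1 \<longrightarrow>
        (\<exists>m M. bounding_sequence N x y L m M \<and> min_neg_overflowing N x y m M)) \<and>
     (\<forall>m M. m \<le> M \<and> min_neg_overflowing N x y m M \<longrightarrow>
        (\<exists>!L. hitomezashi_loop N x y L \<and> homology_class N y L = - 1 \<and>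
              bounding_sequence N x y L m M))"
proof -
  interpret cylindrical_cloth N x y
    using assms by unfold_locales auto
  obtain u v where uv: "0 \<le> u" "u < N" "0 \<le> v" "v < N" "\<And>j. X u \<le> X j" "\<And>j. X j \<le> X v"
    and r: "sum_range N x = X v - X u"
    using X_extrema by blast
  note pos = loops_of_class[OF uv, of 1 "min_pos_overflowing N x y",
      OF disjI1[OF refl] min_pos_overflowing_iff_spans[OF uv _ r], unfolded of_int_1]
  note neg = loops_of_class[OF uv, of "- 1" "min_neg_overflowing N x y",
      OF disjI2[OF refl] min_neg_overflowing_iff_spans[OF uv _ r], unfolded of_int_minus of_int_1]
  show ?thesis
    by (intro conjI allI impI; elim conjE; rule pos neg; assumption)
qed

end
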